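(* Let $\mathcal{C}_1\subseteq\mathbb{F}_{q^m}^n$ be a linear code and $\mathcal{C}_2\subsetneqq\mathcal{C}_1$ a subcode. Then the $i$-th relative generalized rank weight $M_{R,i}(\mathcal{C}_1,\mathcal{C}_2)$ is strictly increasing in $i$. Moreover, $M_{R,0}(\mathcal{C}_1,\mathcal{C}_2)=0$ and, for $0\le i\le\dim(\mathcal{C}_1/\mathcal{C}_2)$, $$M_{R,i}(\mathcal{C}_1,\mathcal{C}_2)=\min\{j:K_{R,j}(\mathcal{C}_1,\mathcal{C}_2)=i\}=\min\{\dim V:V\in\Gamma(\mathbb{F}_{q^m}^n),\ \dim(\mathcal{C}_1\cap V)-\dim(\mathcal{C}_2\cap V)=i\}.$$
   Context: $\mathbb{F}_{q^m}$ is the degree-$m$ extension ($m\ge1$) of the finite field $\mathbb{F}_q$. Linear codes are $\mathbb{F}_{q^m}$-subspaces of $\mathbb{F}_{q^m}^n$; dimensions are over $\mathbb{F}_{q^m}$. For a subspace $V\subseteq\mathbb{F}_{q^m}^n$ put $V^q=\{[v_1^q,\dots,v_n^q]: v\in V\}$. Let $\Gamma(\mathbb{F}_{q^m}^n)$ be the set of $\mathbb{F}_{q^m}$-subspaces $V\subseteq\mathbb{F}_{q^m}^n$ with $V=V^q$, and $\Gamma_i(\mathbb{F}_{q^m}^n)$ those of dimension $i$. For $0\le j\le n$, $K_{R,j}(\mathcal{C}_1,\mathcal{C}_2)=\max_{V\in\Gamma_j(\mathbb{F}_{q^m}^n)}\{\dim(\mathcal{C}_1\cap V)-\dim(\mathcal{C}_2\cap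 V)\}$. For $0\le i\le\dim(\mathcal{C}_1/\mathcal{C}_2)$, $M_{R,i}(\mathcal{C}_1,\mathcal{C}_2)=\min\{\dim V: V\in\Gamma(\mathbb{F}_{q^m}^n),\ \dim(\mathcal{C}_1\cap V)-\dim(\mathcal{C}_2\cap V)\ge i\}$. *)

theory Defs
  imports "HOL-Analysis.Analysis" "HOL-Number_Theory.Prime_Powers"
begin

(* B represents a basis of the quotient space C1 / C2: the cosets b + C2 (b in B) are
   pairwise distinct, linearly independent and spanning, where a vector is zero in the
   quotient iff it lies in C2. *)
definition quotient_basis :: "('a::field ^ 'n) set \<Rightarrow> ('a ^ 'n) set \<Rightarrow> ('a ^ 'n) set \<Rightarrow> bool"
  where "quotient_basis C1 C2 B \<longleftrightarrow> finite B \<and> B \<subseteq> C1 \<and>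
    (\<forall>u. (\<Sum>b\<in>B. u b *s b) \<in> C2 \<longrightarrow> (\<forall>b\<in>B. u b = 0)) \<and>
    (\<forall>v\<in>C1. \<exists>u. v - (\<Sum>b\<in>B. u b *s b) \<in> C2)"

definition quotient_dim :: "('a::field ^ 'n) set \<Rightarrow> ('a ^ 'n) set \<Rightarrow> nat"
  where "quotient_dim C1 C2 = (THE d. \<exists>B. quotient_basis C1 C2 B \<and> card B = d)"

lemma quotient_basis_card:
  fixes C1 C2 :: "('a::field ^ 'n::finite) set"
  assumes sub: "vec.subspace C1" "vec.subspace C2" "C2 \<subseteq> C1" and B: "quotient_basis C1 C2 B"
  shows "card B + vec.dim C2 = vec.dim C1"
proof -
  have fin: "finite B" and BC: "B \<subseteq> C1"
    and ind: "\<And>u b. (\<Sum>b\<in>B. u b *s b) \<in> C2 \<Longrightarrow> b \<in> B \<Longrightarrow> u b = 0"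
    and spn: "\<And>v. v \<in> C1 \<Longrightarrow> \<exists>u. v - (\<Sum>b\<in>B. u b *s b) \<in> C2"
    using B unfolding quotient_basis_def by blast+
  have zero: "0 \<in> C2" using sub(2) by (rule vec.subspace_0)
  have iB: "vec.independent B"
    by (rule vec.independent_if_scalars_zero[OF fin]) (use ind zero in auto)
  have int: "vec.span B \<inter> C2 = {0}"
  proof
    show "vec.span B \<inter> C2 \<subseteq> {0}"
    proof
      fix x assume x: "x \<in> vec.span B \<inter> C2"
      then obtain u where u: "x = (\<Sum>b\<in>B. u b *s b)"
        using vec.span_finite[OF fin] by auto
      have "u b = 0" if "b \<in> B" for b using ind[of u b] x u that by simp
      then show "x \<in> {0}" using u by simp
    qed
  qed (use zero vec.span_zero in auto)
  have BC1: "vec.span B \<subseteq> C1" using BC sub(1) by (rule vec.span_minimal)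
  have "C1 = {x + y |x y. x \<in> vec.span B \<and> y \<in> C2}"
  proof
    show "C1 \<subseteq> {x + y |x y. x \<in> vec.span B \<and> y \<in> C2}"
    proof
      fix v assume "v \<in> C1"
      then obtain u where u: "v - (\<Sum>b\<in>B. u b *s b) \<in> C2" using spn by blast
      have "(\<Sum>b\<in>B. u b *s b) \<in> vec.span B"
        by (intro vec.span_sum vec.span_scale vec.span_base)
      moreover have "v = (\<Sum>b\<in>B. u b *s b) + (v - (\<Sum>b\<in>B. u b *s b))" by simp
      ultimately show "v \<in> {x + y |x y. x \<in> vec.span B \<and> y \<in> C2}" using u by blast
    qed
    show "{x + y |x y. x \<in> vec.span B \<and> y \<in> C2} \<subseteq> C1"
      using BC1 sub vec.subspace_add by blast
  qed
  then show ?thesis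
    using vec.dim_sums_Int[OF vec.subspace_span[of B] sub(2)] int
      vec.dim_span_eq_card_independent[OF iB] by simp
qed

lemma quotient_basis_exists:
  fixes C1 C2 :: "('a::field ^ 'n::finite) set"
  assumes sub: "vec.subspace C1" "vec.subspace C2" "C2 \<subseteq> C1"
  shows "\<exists>B. quotient_basis C1 C2 B"
proof -
  obtain D where D: "D \<subseteq> C2" "vec.independent D" "C2 \<subseteq> vec.span D"
    using vec.basis_exists by metis
  obtain A where A: "D \<subseteq> A" "A \<subseteq> C1" "vec.independent A" "C1 \<subseteq> vec.span A"
    using vec.maximal_independent_subset_extend[of D C1] D sub(3) by blast
  have finA: "finite A" using A(3) vec.finiteI_independent by blast
  have finD: "finite D" using finA A(1) finite_subset by blast
  have split: "(\<Sum>a\<in>A. f a) = (\<Sum>a\<in>A - D. f a) + (\<Sum>a\<in>D. f a)" for f :: "'a ^ 'n \<Rightarrow> 'a ^ 'n"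
    using sum.subset_diff[OF A(1) finA] by blast
  have spanD: "vec.span D \<subseteq> C2" using D(1) sub(2) by (rule vec.span_minimal)
  have "quotient_basis C1 C2 (A - D)"
    unfolding quotient_basis_def
  proof (intro conjI allI impI ballI)
    show "finite (A - D)" "A - D \<subseteq> C1" using finA A by auto
  next
    fix u b assume u: "(\<Sum>b\<in>A - D. u b *s b) \<in> C2" and b: "b \<in> A - D"
    obtain w where w: "(\<Sum>b\<in>A - D. u b *s b) = (\<Sum>b\<in>D. w b *s b)"
      using u D(3) vec.span_finite[OF finD] by auto
    define z where "z a = (if a \<in> D then - w a else u a)" for a
    have "(\<Sum>a\<in>A. z a *s a) = (\<Sum>a\<in>A - D. u a *s a) + (\<Sum>a\<in>D. - (w a *s a))"
      unfolding split by (intro arg_cong2[of _ _ _ _ "(+)"] sum.cong) (auto simp: z_def)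
    also have "\<dots> = 0" using w by (simp add: sum_negf)
    finally have "z b = 0"
      using A(3) b vec.independent_explicit[of A] by blast
    then show "u b = 0" using b by (simp add: z_def)
  next
    fix v assume "v \<in> C1"
    then obtain u where u: "v = (\<Sum>b\<in>A. u b *s b)"
      using A(4) vec.span_finite[OF finA] by auto
    have "(\<Sum>b\<in>D. u b *s b) \<in> C2"
      using spanD by (meson subsetD vec.span_base vec.span_scale vec.span_sum)
    then have "v - (\<Sum>b\<in>A - D. u b *s b) \<in> C2" unfolding u split by simp
    then show "\<exists>u. v - (\<Sum>b\<in>A - D. u b *s b) \<in> C2" by blast
  qed
  then show ?thesis by blast
qed

lemma quotient_dim_eq:
  fixes C1 C2 :: "('a::field ^ 'n::finite) set"
  assumes "vec.subspace C1" "vec.subspace C2" "C2 \<subseteq> C1"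
  shows "quotient_dim C1 C2 = vec.dim C1 - vec.dim C2"
  unfolding quotient_dim_def
proof (rule the_equality)
  show "\<exists>B. quotient_basis C1 C2 B \<and> card B = vec.dim C1 - vec.dim C2"
    using quotient_basis_exists[OF assms] quotient_basis_card[OF assms] by (metis add_diff_cancel_right')
qed (use quotient_basis_card[OF assms] in force)

definition frob_image :: "nat \<Rightarrow> ('a::field ^ 'n) set \<Rightarrow> ('a ^ 'n) set"
  where "frob_image q V = (\<lambda>v. \<chi> k. (v $ k) ^ q) ` V"

definition Gamma_spaces :: "nat \<Rightarrow> ('a::field ^ 'n) set set"
  where "Gamma_spaces q = {V. vec.subspace V \<and> V = frob_image q V}"

definition Gamma_dim :: "nat \<Rightarrow> nat \<Rightarrow> ('a::field ^ 'n) set set"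
  where "Gamma_dim q i = {V \<in> Gamma_spaces q. vec.dim V = i}"

(* The natural-number subtraction does not truncate, since C2 is always a subspace of C1. *)
definition rel_dim :: "('a::field ^ 'n) set \<Rightarrow> ('a ^ 'n) set \<Rightarrow> ('a ^ 'n) set \<Rightarrow> nat"
  where "rel_dim C1 C2 V = vec.dim (C1 \<inter> V) - vec.dim (C2 \<inter> V)"

(* Meaningful for j \<le> CARD('n); otherwise Max is taken over the empty set. *)
definition K_R :: "nat \<Rightarrow> ('a::field ^ 'n) set \<Rightarrow> ('a ^ 'n) set \<Rightarrow> nat \<Rightarrow> nat"
  where "K_R q C1 C2 j = Max {rel_dim C1 C2 V | V. V \<in> Gamma_dim q j}"

(* Meaningful for i \<le> quotient_dim C1 C2; otherwise Min is taken over the empty set. *)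
definition M_R :: "nat \<Rightarrow> ('a::field ^ 'n) set \<Rightarrow> ('a ^ 'n) set \<Rightarrow> nat \<Rightarrow> nat"
  where "M_R q C1 C2 i = Min {vec.dim V | V. V \<in> Gamma_spaces q \<and> i \<le> rel_dim C1 C2 V}"

end

theory Submission
  imports Defs
begin

text \<open>Intersecting a Frobenius-stable space \<open>V \<noteq> 0\<close> with a coordinate hyperplane that does not
  contain it gives a Frobenius-stable space of dimension one less, whose relative dimension drops by
  at most one. Hence a space of minimal dimension with relative dimension at least \<open>i\<close> has relative
  dimension exactly \<open>i\<close>, and each value of the weight is larger than the preceding one.\<close>

text \<open>Multiplication by a nonzero \<open>x\<close> permutes the nonzero elements. Comparing
  the product of all of them before and after, and cancelling it, leaves \<open>x\<close> raised to
  their number equal to 1.\<close>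

lemma power_card_eq:
  fixes x :: "'a::{field,finite}"
  shows "x ^ CARD('a) = x"
proof (cases "x = 0")
  case False
  let ?U = "UNIV - {0::'a}"
  have "prod (\<lambda>y. y) ?U = prod ((*) x) ?U"
    by (rule prod.reindex_bij_witness[of _ "(*) x" "\<lambda>y. y / x"]) (use False in auto)
  also have "\<dots> = x ^ card ?U * prod (\<lambda>y. y) ?U"
    by (simp add: prod.distrib)
  finally have "x ^ card ?U = 1"
    by simp
  moreover have "CARD('a) = Suc (card ?U)"
    by (rule card.remove) auto
  ultimately show ?thesis by (metis power_Suc mult_1_right)
qed simp

text \<open>Gives an explicit \<open>q\<close>-th root of every field element, so the
  \<open>q\<close>-th power map is onto.\<close>

lemma power_right_inverse:
  fixes x :: "'a::{field,finite}"
  assumes "CARD('a) = q ^ m" "m \<ge> 1"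
  shows "(x ^ q ^ (m - 1)) ^ q = x"
proof -
  have "q ^ (m - 1) * q = q ^ m"
    using \<open>m \<ge> 1\<close> by (cases m) auto
  then show ?thesis
    using power_card_eq[of x] assms(1) by (simp flip: power_mult)
qed

text \<open>Stability is an equality of sets, so every vector needs a Frobenius preimage; it is
  found coordinatewise by taking \<open>q\<close>-th roots.\<close>

lemma UNIV_in_Gamma_spaces:
  assumes "CARD('a::{field,finite}) = q ^ m" "m \<ge> 1"
  shows "(UNIV :: ('a ^ 'n) set) \<in> Gamma_spaces q"
proof -
  have "w \<in> frob_image q UNIV" for w :: "'a ^ 'n"
  proof -
    have "w = (\<chi> k. ((\<chi> k. (w $ k) ^ q ^ (m - 1)) $ k) ^ q)"
      by (simp add: vec_eq_iff power_right_inverse[OF assms] del: One_nat_def)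
    then show ?thesis unfolding frob_image_def by blast
  qed
  then show ?thesis by (auto simp: Gamma_spaces_def)
qed

lemma zero_in_Gamma_spaces:
  assumes "q > 0"
  shows "{0 :: 'a::field ^ 'n} \<in> Gamma_spaces q"
proof -
  have "(\<chi> k. ((0 :: 'a ^ 'n) $ k) ^ q) = 0"
    using assms by (simp add: vec_eq_iff)
  then show ?thesis
    by (simp add: Gamma_spaces_def frob_image_def)
qed

text \<open>Cut \<open>V\<close> with \<open>x $ k = 0\<close>, where some \<open>v\<close> in
  \<open>V\<close> has \<open>v $ k\<close> nonzero. As a field element vanishes exactly when its
  \<open>q\<close>-th power does, Frobenius both preserves and reflects this equation, so the
  section inherits stability from \<open>V\<close>.\<close>

lemma Gamma_spaces_hyperplane:
  fixes V :: "('a::field ^ 'n::finite) set"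
  assumes "q > 0" "V \<in> Gamma_spaces q" "vec.dim V = Suc d"
  obtains W where "W \<in> Gamma_spaces q" "W \<subseteq> V" "vec.dim W = d"
proof -
  have V: "vec.subspace V" "V = frob_image q V"
    using assms(2) by (auto simp: Gamma_spaces_def)
  have "\<not> V \<subseteq> {0}"
    using assms(3) vec.dim_subset[of V "{0}"] by auto
  then obtain v where v: "v \<in> V" "v \<noteq> 0" by blast
  then obtain k where k: "v $ k \<noteq> 0" by (auto simp: vec_eq_iff)
  define W where "W = {x \<in> V. x $ k = 0}"
  have W: "vec.subspace W"
    using V(1) by (auto simp: W_def vec.subspace_def)
  have "W = frob_image q W"
  proof
    show "W \<subseteq> frob_image q W"
    proof
      fix x assume x: "x \<in> W"
      \<comment> \<open>A preimage \<open>y\<close> taken in \<open>V\<close> already lies in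
        \<open>W\<close>: its \<open>k\<close>-th coordinate has \<open>q\<close>-th power
        \<open>x $ k = 0\<close>.\<close>
      then obtain y where "y \<in> V" "x = (\<chi> i. (y $ i) ^ q)"
        using V(2) by (auto simp: W_def frob_image_def)
      then show "x \<in> frob_image q W"
        using x by (auto simp: W_def frob_image_def)
    qed
    show "frob_image q W \<subseteq> W"
    proof
      fix x assume "x \<in> frob_image q W"
      then obtain y where y: "y \<in> V" "y $ k = 0" "x = (\<chi> i. (y $ i) ^ q)"
        by (auto simp: W_def frob_image_def)
      then have "x \<in> V" using V(2) by (auto simp: frob_image_def)
      then show "x \<in> W" using y \<open>q > 0\<close> by (simp add: W_def)
    qed
  qed
  then have "W \<in> Gamma_spaces q" using W by (simp add: Gamma_spaces_def)
  moreover have "V = vec.span (insert v W)"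
  proof
    show "V \<subseteq> vec.span (insert v W)"
    proof
      fix x assume x: "x \<in> V"
      \<comment> \<open>Subtracting this multiple of \<open>v\<close> kills coordinate
        \<open>k\<close>, so \<open>v\<close> alone extends \<open>W\<close> to
        \<open>V\<close>.\<close>
      let ?c = "x $ k / v $ k"
      have "x - ?c *s v \<in> W"
        using x v(1) V(1) k by (simp add: W_def vec.subspace_diff vec.subspace_scale)
      then show "x \<in> vec.span (insert v W)"
        using vec.span_breakdown_eq[of x v W] vec.span_base by blast
    qed
    show "vec.span (insert v W) \<subseteq> V"
      using v(1) V(1) by (intro vec.span_minimal) (auto simp: W_def)
  qed
  moreover have "v \<notin> vec.span W"
    using k W by (simp add: vec.span_eq_iff[THEN iffD2] W_def)
  ultimately have "vec.dim V = Suc (vec.dim W)"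
    using vec.dim_insert[of v W] by simp
  then show thesis
    using that[of W] \<open>W \<in> Gamma_spaces q\<close> assms(3) by (simp add: W_def)
qed

text \<open>The sum of \<open>C \<inter> V\<close> and \<open>W\<close> stays inside
  \<open>V\<close>, hence has dimension at most one above that of \<open>W\<close>. The two summands
  meet in \<open>C \<inter> W\<close>, and the dimension formula for sums gives the bound.\<close>

lemma dim_Int_hyperplane:
  fixes C V W :: "('a::field ^ 'n::finite) set"
  assumes "vec.subspace C" "vec.subspace V" "vec.subspace W" "W \<subseteq> V" "vec.dim V = Suc (vec.dim W)"
  shows "vec.dim (C \<inter> V) \<le> Suc (vec.dim (C \<inter> W))"
proof -
  have "{x + y |x y. x \<in> C \<inter> V \<and> y \<in> W} \<subseteq> V"
    using assms(2,4) vec.subspace_add by blast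
  then have "vec.dim {x + y |x y. x \<in> C \<inter> V \<and> y \<in> W} \<le> vec.dim V"
    by (rule vec.dim_subset)
  moreover have "C \<inter> V \<inter> W = C \<inter> W" using assms(4) by blast
  ultimately show ?thesis
    using vec.dim_sums_Int[OF vec.subspace_inter[OF assms(1,2)] assms(3)] assms(5) by simp
qed

text \<open>On passing to a stable hyperplane of \<open>V\<close>, the \<open>C1\<close> part loses
  at most one dimension and the \<open>C2\<close> part cannot grow.\<close>

lemma Gamma_spaces_rel_dim_step:
  fixes C1 C2 V :: "('a::field ^ 'n::finite) set"
  assumes "q > 0" "vec.subspace C1" "V \<in> Gamma_spaces q" "vec.dim V = Suc d"
  obtains W where "W \<in> Gamma_spaces q" "vec.dim W = d" "rel_dim C1 C2 V \<le> Suc (rel_dim C1 C2 W)"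
proof -
  obtain W where W: "W \<in> Gamma_spaces q" "W \<subseteq> V" "vec.dim W = d"
    using Gamma_spaces_hyperplane[OF assms(1,3,4)] .
  have "vec.dim (C1 \<inter> V) \<le> Suc (vec.dim (C1 \<inter> W))"
    using W assms by (intro dim_Int_hyperplane) (auto simp: Gamma_spaces_def)
  moreover have "vec.dim (C2 \<inter> W) \<le> vec.dim (C2 \<inter> V)"
    using W(2) by (intro vec.dim_subset) blast
  ultimately show thesis
    using that W unfolding rel_dim_def by fastforce
qed

text \<open>Descend from the whole space one stable hyperplane at a time. This makes
  \<open>K_R\<close> a maximum over a nonempty set.\<close>

lemma Gamma_dim_nonempty:
  assumes "CARD('a::{field,finite}) = q ^ m" "m \<ge> 1" "q > 0" "j \<le> CARD('n::finite)"
  shows "(Gamma_dim q j :: ('a ^ 'n) set set) \<noteq> {}"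
  using assms(4)
proof (induction rule: inc_induct)
  case base
  show ?case
    using UNIV_in_Gamma_spaces[OF assms(1,2)] by (auto simp: Gamma_dim_def vec.dim_UNIV card_cart_basis)
next
  case (step j)
  then obtain V :: "('a ^ 'n) set" where V: "V \<in> Gamma_spaces q" "vec.dim V = Suc j"
    by (auto simp: Gamma_dim_def)
  obtain W where "W \<in> Gamma_spaces q" "W \<subseteq> V" "vec.dim W = j"
    using Gamma_spaces_hyperplane[OF assms(3) V] .
  then have "W \<in> Gamma_dim q j" by (simp add: Gamma_dim_def)
  then show ?case by blast
qed

text \<open>The nonemptiness clauses ensure that each \<open>Min\<close> is a genuine minimum, and
  the bound \<open>j \<le> CARD('n)\<close> excludes indices at which \<open>K_R\<close> would be
  the maximum of an empty set.\<close>

theorem lemma9: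
  fixes C1 C2 :: "('a::{field,finite} ^ 'n::finite) set" and q m :: nat
  assumes "primepow q" and "m \<ge> 1" and "CARD('a) = q ^ m"
    and "vec.subspace C1" and "vec.subspace C2" and "C2 \<subset> C1"
  shows "strict_mono_on {0..quotient_dim C1 C2} (M_R q C1 C2) \<and>
    M_R q C1 C2 0 = 0 \<and>
    (\<forall>i \<le> quotient_dim C1 C2.
      {j. j \<le> CARD('n) \<and> K_R q C1 C2 j = i} \<noteq> {} \<and>
      M_R q C1 C2 i = Min {j. j \<le> CARD('n) \<and> K_R q C1 C2 j = i} \<and>
      {vec.dim V | V. V \<in> Gamma_spaces q \<and> rel_dim C1 C2 V = i} \<noteq> {} \<and>
      M_R q C1 C2 i = Min {vec.dim V | V. V \<in> Gamma_spaces q \<and> rel_dim C1 C2 V = i})"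
proof -
  have q: "q > 0" using assms(1) by (rule primepow_gt_0_nat)
  let ?r = "rel_dim C1 C2" and ?M = "M_R q C1 C2" and ?Q = "quotient_dim C1 C2"
  have fin: "finite {f V | V. P V}" for f :: "('a ^ 'n) set \<Rightarrow> nat" and P
    by (rule finite_image_set) simp
  have r_UNIV: "?r UNIV = ?Q"
    using assms by (simp add: rel_dim_def quotient_dim_eq psubset_imp_subset)
  have r_0: "?r V = 0" if "vec.dim V = 0" for V
  proof -
    have "vec.dim (C1 \<inter> V) \<le> vec.dim V" by (intro vec.dim_subset) simp
    then show ?thesis using that unfolding rel_dim_def by linarith
  qed
  have M_le: "?M i \<le> vec.dim V" if "V \<in> Gamma_spaces q" "i \<le> ?r V" for i V
    unfolding M_R_def using that by (intro Min_le fin) auto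
  \<comment> \<open>If \<open>?r V\<close> exceeded \<open>i\<close>, a stable hyperplane of
    \<open>V\<close> would still have relative dimension at least \<open>i\<close>, against the
    minimality of \<open>vec.dim V\<close>.\<close>
  have M_eq: "?r V = i" if V: "V \<in> Gamma_spaces q" "i \<le> ?r V" "vec.dim V = ?M i" for i V
  proof (cases "vec.dim V")
    case 0
    then show ?thesis using r_0 V(2) by simp
  next
    case (Suc d)
    obtain W where W: "W \<in> Gamma_spaces q" "vec.dim W = d" "?r V \<le> Suc (?r W)"
      using Gamma_spaces_rel_dim_step[OF q assms(4) V(1) Suc] .
    have "\<not> i \<le> ?r W" using M_le[OF W(1), of i] W(2) Suc V(3) by auto
    then show ?thesis using W(3) V(2) by simp
  qed
  have M_ex: "\<exists>V \<in> Gamma_spaces q. ?r V = i \<and> vec.dim V = ?M i" if "i \<le> ?Q" for i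
  proof -
    \<comment> \<open>The whole space has relative dimension \<open>?Q\<close>, so it is a candidate
      for every admissible \<open>i\<close>.\<close>
    have "(UNIV :: ('a ^ 'n) set) \<in> Gamma_spaces q \<and> i \<le> ?r UNIV"
      using UNIV_in_Gamma_spaces[OF assms(3,2)] r_UNIV that by simp
    then have "{vec.dim V | V. V \<in> Gamma_spaces q \<and> i \<le> ?r V} \<noteq> {}"
      by blast
    then have "?M i \<in> {vec.dim V | V. V \<in> Gamma_spaces q \<and> i \<le> ?r V}"
      unfolding M_R_def by (rule Min_in[OF fin])
    then obtain V where V: "V \<in> Gamma_spaces q" "i \<le> ?r V" "vec.dim V = ?M i"
      unfolding mem_Collect_eq by metis
    then show ?thesis using M_eq[OF V] by blast
  qed
  have "strict_mono_on {0..?Q} ?M"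
  proof (rule strict_mono_onI)
    fix i j assume "j \<in> {0..?Q}" "i < j"
    then obtain V where V: "V \<in> Gamma_spaces q" "?r V = j" "vec.dim V = ?M j"
      using M_ex[of j] by auto
    have "vec.dim V \<noteq> 0"
      using r_0[of V] V(2) \<open>i < j\<close> by linarith
    then obtain d where d: "vec.dim V = Suc d"
      by (rule not0_implies_Suc[THEN exE])
    obtain W where W: "W \<in> Gamma_spaces q" "vec.dim W = d" "?r V \<le> Suc (?r W)"
      using Gamma_spaces_rel_dim_step[OF q assms(4) V(1) d] .
    \<comment> \<open>The hyperplane retains relative dimension at least \<open>j - 1\<close>, so it
      competes for \<open>?M i\<close> with dimension \<open>?M j - 1\<close>.\<close>
    have "i \<le> ?r W" using W(3) V(2) \<open>i < j\<close> by linarith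
    then show "?M i < ?M j"
      using M_le[OF W(1)] W(2) V(3) d by (metis le_imp_less_Suc)
  qed
  moreover have "?M 0 = 0"
    using M_le[OF zero_in_Gamma_spaces[OF q], of 0] by simp
  moreover have "\<forall>i \<le> ?Q.
      {j. j \<le> CARD('n) \<and> K_R q C1 C2 j = i} \<noteq> {} \<and>
      ?M i = Min {j. j \<le> CARD('n) \<and> K_R q C1 C2 j = i} \<and>
      {vec.dim V | V. V \<in> Gamma_spaces q \<and> ?r V = i} \<noteq> {} \<and>
      ?M i = Min {vec.dim V | V. V \<in> Gamma_spaces q \<and> ?r V = i}"
  proof (intro allI impI)
    fix i assume i: "i \<le> ?Q"
    obtain V where V: "V \<in> Gamma_spaces q" "?r V = i" "vec.dim V = ?M i"
      using M_ex[OF i] by blast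
    \<comment> \<open>The value \<open>i\<close> is attained by \<open>V\<close>. A stable space of
      dimension \<open>?M i\<close> with relative dimension at least \<open>i\<close> is itself
      minimal, so \<open>M_eq\<close> rules out any larger value.\<close>
    have "K_R q C1 C2 (?M i) = i"
      unfolding K_R_def
    proof (rule Max_eqI)
      fix y assume "y \<in> {?r V | V. V \<in> Gamma_dim q (?M i)}"
      then obtain U where "U \<in> Gamma_spaces q" "vec.dim U = ?M i" "y = ?r U"
        by (auto simp: Gamma_dim_def)
      then show "y \<le> i" using M_eq[of U i] by linarith
    qed (rule fin, use V in \<open>auto simp: Gamma_dim_def\<close>)
    moreover have "?M i \<le> CARD('n)"
      using vec.dim_subset[of V UNIV] V(3) by (simp add: vec.dim_UNIV card_cart_basis)
    ultimately have K_mem: "?M i \<in> {j. j \<le> CARD('n) \<and> K_R q C1 C2 j = i}" by simp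
    \<comment> \<open>The maximum \<open>K_R q C1 C2 j\<close> is attained by a stable space of
      dimension \<open>j\<close>, which is then a candidate for \<open>?M i\<close>.\<close>
    have K_min: "?M i \<le> j" if j: "j \<in> {j. j \<le> CARD('n) \<and> K_R q C1 C2 j = i}" for j
    proof -
      have "(Gamma_dim q j :: ('a ^ 'n) set set) \<noteq> {}"
        using Gamma_dim_nonempty[OF assms(3,2) q] j by blast
      then have "{?r V | V. V \<in> Gamma_dim q j} \<noteq> {}"
        by blast
      then have "K_R q C1 C2 j \<in> {?r V | V. V \<in> Gamma_dim q j}"
        unfolding K_R_def by (rule Max_in[OF fin])
      then obtain U where "U \<in> Gamma_dim q j" "?r U = i"
        using j unfolding mem_Collect_eq by metis
      then show ?thesis using M_le[of U i] by (simp add: Gamma_dim_def)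
    qed
    have "?M i = Min {j. j \<le> CARD('n) \<and> K_R q C1 C2 j = i}"
      using K_mem K_min by (intro Min_eqI[symmetric]) auto
    moreover have "?M i = Min {vec.dim V | V. V \<in> Gamma_spaces q \<and> ?r V = i}"
    proof (intro Min_eqI[symmetric] fin)
      show "?M i \<in> {vec.dim V | V. V \<in> Gamma_spaces q \<and> ?r V = i}"
        using V unfolding mem_Collect_eq by metis
    qed (use M_le in auto)
    moreover have "{j. j \<le> CARD('n) \<and> K_R q C1 C2 j = i} \<noteq> {}"
      using K_mem by (rule ex_in_conv[THEN iffD1, OF exI])
    moreover have "{vec.dim V | V. V \<in> Gamma_spaces q \<and> ?r V = i} \<noteq> {}"
      using V(1,2) by blast
    ultimately show "{j. j \<le> CARD('n) \<and> K_R q C1 C2 j = i} \<noteq> {} \<and>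
      ?M i = Min {j. j \<le> CARD('n) \<and> K_R q C1 C2 j = i} \<and>
      {vec.dim V | V. V \<in> Gamma_spaces q \<and> ?r V = i} \<noteq> {} \<and>
      ?M i = Min {vec.dim V | V. V \<in> Gamma_spaces q \<and> ?r V = i}"
      by (intro conjI)
  qed
  ultimately show ?thesis by (intro conjI)
qed

end
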